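(* Let $A$ be a finite subset of an additive group $G$. Then $\phi(A)=1$ if and only if one of the following is true: (1) $A=H$, where $H\le G$ is a subgroup of $G$; (2) $A=H\setminus\{0\}$, where $H\le G$ is a $2$-torsion subgroup of $G$ (thus $2x=0$ for all $x\in H$); (3) $A=\{b\}$ for some $b\in G$; (4) $A=\{b,0\}$ for some $b\in G$; (5) $A=\{b,0,-b\}$ for some $b\in G$.
   Context: An additive group is an abelian group with group operation denoted by $+$; for $x\in G$ write $2x:=x+x$. If $A,B$ are two subsets of an additive group $G$, then $B$ is sum-avoiding in $A$ if there do not exist distinct $b_1,b_2\in B$ such that $b_1+b_2\in A$. Define $\phi(A):=\sup\{|B| : B\subseteq A,\ B \text{ finite and sum-avoiding in } A\}$, where $|B|$ denotes the cardinality of the finite set $B$.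
   Formalization: In case (2) the subgroup H is additionally required to be nontrivial (H ≠ {0}), since H = {0} would give A = ∅, for which φ(A) = 0 and not 1. *)

theory Defs
  imports "HOL-Algebra.AbelCoset" "HOL-Library.Extended_Nat"
begin

text \<open>
  An additive group is rendered by the locale \<open>abelian_group\<close>, which only constrains the carrier and
  the fields \<open>\<oplus>\<close>, \<open>\<zero>\<close> of the underlying ring record; the multiplicative fields are
  arbitrary and play no role.  Its subgroups are the \<open>additive_subgroup\<close>s.
\<close>

definition sum_avoiding :: "('g, 'm) ring_scheme \<Rightarrow> 'g set \<Rightarrow> 'g set \<Rightarrow> bool" where
  "sum_avoiding G B A \<longleftrightarrow>
     \<not> (\<exists>b1\<in>B. \<exists>b2\<in>B. b1 \<noteq> b2 \<and> b1 \<oplus>\<^bsub>G\<^esub> b2 \<in> A)"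

text \<open>The supremum is taken in \<open>enat\<close>, so it is meaningful for infinite \<open>A\<close> as well.\<close>

definition phi :: "('g, 'm) ring_scheme \<Rightarrow> 'g set \<Rightarrow> enat" where
  "phi G A = Sup {enat (card B) | B. B \<subseteq> A \<and> finite B \<and> sum_avoiding G B A}"

end

theory Submission
  imports Defs
begin

text \<open>
  The condition \<open>phi G A = 1\<close> says that \<open>A\<close> is nonempty and contains the sum of any two of its
  \<^emph>\<open>distinct\<close> elements, so the only thing that keeps \<open>A\<close> from being closed under addition is the
  doubles. The classification rests on counting: for \<open>a \<in> A\<close>, translation by \<open>a\<close> sends
  \<open>A - {a}\<close> injectively into \<open>A\<close>, so it misses exactly one point of \<open>A\<close>
  (\<open>at_most_one_missed\<close>). If the double of \<open>a\<close> lies in \<open>A\<close>, the missed point is that double and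
  \<open>A\<close> is closed under subtracting \<open>a\<close>; otherwise all points of \<open>A\<close> but one stay in \<open>A\<close> when
  \<open>a\<close> is subtracted.

  If all doubles lie in \<open>A\<close>, then \<open>A\<close> is closed under subtraction, hence a subgroup. Otherwise
  fix \<open>a \<in> A\<close> with \<open>a \<oplus> a \<notin> A\<close>. The tool is then to write \<open>a \<oplus> a\<close> as a sum of two elements
  of \<open>A\<close>, such as \<open>a \<oplus> y\<close> and \<open>a \<ominus> y\<close>: these two must coincide, so \<open>y\<close> has order at most two.
  When \<open>\<zero> \<notin> A\<close>, no double lies in \<open>A\<close>, and the tool applies to every pair, so that \<open>A\<close> is a
  singleton or a 2-torsion group without \<open>\<zero>\<close> (\<open>zero_free_classification\<close>). When \<open>\<zero> \<in> A\<close>, the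
  tool excludes every element other than \<open>\<zero>\<close>, \<open>a\<close> and \<open>\<ominus> a\<close>
  (\<open>subset_zero_plus_minus\<close>).
\<close>

context abelian_group
begin

definition closed_under_distinct_sums :: "'a set \<Rightarrow> bool" where
  "closed_under_distinct_sums A \<longleftrightarrow>
     A \<subseteq> carrier G \<and> (\<forall>x\<in>A. \<forall>y\<in>A. x \<noteq> y \<longrightarrow> x \<oplus> y \<in> A)"

lemma distinct_sum_mem:
  "closed_under_distinct_sums A \<Longrightarrow> x \<in> A \<Longrightarrow> y \<in> A \<Longrightarrow> x \<noteq> y \<Longrightarrow> x \<oplus> y \<in> A"
  by (simp add: closed_under_distinct_sums_def)

lemma distinct_sums_carrier:
  "closed_under_distinct_sums A \<Longrightarrow> x \<in> A \<Longrightarrow> x \<in> carrier G"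
  by (auto simp: closed_under_distinct_sums_def)

lemma minus_eq_iff_eq_add:
  assumes "x \<in> carrier G" "y \<in> carrier G" "z \<in> carrier G"
  shows "x \<ominus> y = z \<longleftrightarrow> x = z \<oplus> y"
  using assms by (auto simp: a_minus_def a_assoc r_neg l_neg)

text \<open>
  Singletons are always sum-avoiding, so \<open>phi\<close> is at least 1 on a nonempty set, and it exceeds 1 as
  soon as some pair is sum-avoiding.
\<close>

lemma phi_eq_1_iff:
  assumes "A \<subseteq> carrier G"
  shows "phi G A = 1 \<longleftrightarrow> A \<noteq> {} \<and> closed_under_distinct_sums A"
proof
  assume phi: "phi G A = 1"
  have le: "card B \<le> 1" if "B \<subseteq> A" "finite B" "sum_avoiding G B A" for B
  proof -
    have "enat (card B) \<le> phi G A"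
      unfolding phi_def by (rule Sup_upper) (use that in blast)
    then show ?thesis by (simp add: phi one_enat_def)
  qed
  have "x \<oplus> y \<in> A" if "x \<in> A" "y \<in> A" "x \<noteq> y" for x y
  proof (rule ccontr)
    assume "x \<oplus> y \<notin> A"
    moreover have "y \<oplus> x = x \<oplus> y"
      using that assms by (intro a_comm) auto
    ultimately have "sum_avoiding G {x, y} A"
      by (auto simp: sum_avoiding_def)
    with le[of "{x, y}"] that show False by simp
  qed
  moreover have "A \<noteq> {}"
  proof
    assume "A = {}"
    then have "phi G A \<le> 0"
      unfolding phi_def by (intro Sup_least) (auto simp: zero_enat_def)
    with phi show False by simp
  qed
  ultimately show "A \<noteq> {} \<and> closed_under_distinct_sums A"
    using assms by (simp add: closed_under_distinct_sums_def)
next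
  assume A: "A \<noteq> {} \<and> closed_under_distinct_sums A"
  have "card B \<le> 1" if "B \<subseteq> A" "finite B" "sum_avoiding G B A" for B
  proof -
    have "x = y" if "x \<in> B" "y \<in> B" for x y
      using that \<open>B \<subseteq> A\<close> \<open>sum_avoiding G B A\<close> A
      by (meson distinct_sum_mem subsetD sum_avoiding_def)
    then show ?thesis using \<open>finite B\<close> by (simp add: card_le_Suc0_iff_eq)
  qed
  then have "phi G A \<le> 1"
    unfolding phi_def by (intro Sup_least) (auto simp: one_enat_def)
  moreover obtain a where "a \<in> A" using A by blast
  then have "{a} \<subseteq> A" "finite {a}" "sum_avoiding G {a} A"
    by (simp_all add: sum_avoiding_def)
  then have "enat (card {a}) \<le> phi G A"
    unfolding phi_def by (intro Sup_upper) blast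
  then have "1 \<le> phi G A" by (simp add: one_enat_def)
  ultimately show "phi G A = 1" by (rule antisym)
qed

text \<open>
  The translate of \<open>A - {a}\<close> by \<open>a\<close> lies in \<open>A\<close> and has only one element less than \<open>A\<close>, so it
  cannot miss two points \<open>x\<close> and \<open>y\<close> of \<open>A\<close>.
\<close>

lemma at_most_one_missed:
  assumes A: "closed_under_distinct_sums A" and "finite A"
    and mem: "a \<in> A" "x \<in> A" "y \<in> A" and "x \<noteq> y"
    and missed: "x \<ominus> a \<notin> A - {a}"
  shows "y \<ominus> a \<in> A - {a}"
proof (rule ccontr)
  assume missed': "y \<ominus> a \<notin> A - {a}"
  define T where "T = (\<lambda>z. z \<oplus> a) ` (A - {a})"
  note carr = distinct_sums_carrier[OF A]
  have "z \<ominus> a \<in> A - {a}" if "z \<in> T" for z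
    using that carr \<open>a \<in> A\<close> unfolding T_def
    by (auto simp: a_minus_def a_assoc r_neg)
  with missed missed' have "x \<notin> T" "y \<notin> T" by blast+
  moreover have "T \<subseteq> A"
    using distinct_sum_mem[OF A] \<open>a \<in> A\<close> by (auto simp: T_def)
  ultimately have "card T \<le> card (A - {x, y})"
    using \<open>finite A\<close> by (intro card_mono) auto
  also have "\<dots> = card A - 2"
    using mem \<open>x \<noteq> y\<close> by (simp add: card_Diff_subset)
  finally have "card T \<le> card A - 2" .
  moreover have "inj_on (\<lambda>z. z \<oplus> a) (A - {a})"
    using carr \<open>a \<in> A\<close> by (auto simp: inj_on_def)
  then have "card T = card A - 1"
    using \<open>a \<in> A\<close> by (simp add: T_def card_image)
  moreover have "card {x, y} \<le> card A"
    using mem \<open>finite A\<close> by (intro card_mono) auto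
  then have "2 \<le> card A" using \<open>x \<noteq> y\<close> by simp
  ultimately show False by simp
qed

text \<open>Here the missed point is the double itself, since subtracting \<open>a\<close> from it gives \<open>a\<close>.\<close>

lemma diff_mem_if_double_mem:
  assumes A: "closed_under_distinct_sums A" and "finite A"
    and "a \<in> A" "x \<in> A" "a \<oplus> a \<in> A"
  shows "x \<ominus> a \<in> A"
proof -
  have "(a \<oplus> a) \<ominus> a = a"
    using distinct_sums_carrier[OF A \<open>a \<in> A\<close>] by (simp add: minus_eq_iff_eq_add)
  then show ?thesis
    using at_most_one_missed[OF A \<open>finite A\<close> \<open>a \<in> A\<close> \<open>a \<oplus> a \<in> A\<close> \<open>x \<in> A\<close>] \<open>a \<in> A\<close>
    by (cases "x = a \<oplus> a") auto
qed

text \<open>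
  Two elements of \<open>A\<close> whose sum is a missing double must be equal; applied to \<open>a \<oplus> y\<close> and
  \<open>a \<ominus> y\<close> this bounds the order of \<open>y\<close>.
\<close>

lemma double_zero_if_sum_diff_mem:
  assumes A: "closed_under_distinct_sums A"
    and carr: "a \<in> carrier G" "y \<in> carrier G"
    and mem: "a \<oplus> y \<in> A" "a \<ominus> y \<in> A" and "a \<oplus> a \<notin> A"
  shows "y \<oplus> y = \<zero>"
proof -
  have "(a \<oplus> y) \<oplus> (a \<ominus> y) = a \<oplus> a"
    using carr by (simp add: a_minus_def a_ac r_neg r_neg1 r_neg2)
  then have "a \<ominus> y = a \<oplus> y"
    using distinct_sum_mem[OF A mem] \<open>a \<oplus> a \<notin> A\<close> by metis
  then have "a = a \<oplus> (y \<oplus> y)"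
    using carr by (simp add: minus_eq_iff_eq_add a_assoc)
  then show ?thesis
    using carr add.l_cancel_one[of a "y \<oplus> y"] by simp
qed

lemma additive_subgroupI_diff:
  assumes "H \<subseteq> carrier G" "H \<noteq> {}" "\<And>x y. x \<in> H \<Longrightarrow> y \<in> H \<Longrightarrow> x \<ominus> y \<in> H"
  shows "additive_subgroup H G"
proof -
  have zero: "\<zero> \<in> H"
    using assms by (metis all_not_in_conv a_minus_def r_neg subsetD)
  have neg: "\<ominus> x \<in> H" if "x \<in> H" for x
    using assms(1) assms(3)[OF zero that] that by (auto simp: a_minus_def)
  have "x \<oplus> y \<in> H" if "x \<in> H" "y \<in> H" for x y
    using assms(1) assms(3)[OF that(1) neg[OF that(2)]] that by (auto simp: a_minus_def)
  with assms(1,2) neg show ?thesis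
    by (intro additive_subgroup.intro add.subgroupI) (auto simp: a_inv_def)
qed

text \<open>
  Without \<open>\<zero>\<close> there are no doubles in \<open>A\<close>: a double \<open>a \<oplus> a \<in> A\<close> would put \<open>a \<ominus> a\<close> into \<open>A\<close>.
  So for each \<open>a\<close> the missed point is \<open>a\<close>, any other \<open>y\<close> gives \<open>y \<oplus> y = \<zero>\<close>, and the roles of
  \<open>a\<close> and \<open>y\<close> can be exchanged.
\<close>

lemma zero_free_classification:
  assumes A: "closed_under_distinct_sums A" and "finite A" and "\<zero> \<notin> A"
    and "a \<in> A" and "A \<noteq> {a}"
  shows "additive_subgroup (insert \<zero> A) G \<and> (\<forall>x\<in>insert \<zero> A. x \<oplus> x = \<zero>)"
proof -
  note carr = distinct_sums_carrier[OF A]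
  have no_double: "x \<oplus> x \<notin> A" if "x \<in> A" for x
    using diff_mem_if_double_mem[OF A \<open>finite A\<close> that that] carr[OF that] \<open>\<zero> \<notin> A\<close>
    by (auto simp: a_minus_def r_neg)
  have diff: "x \<ominus> y \<in> A" if "x \<in> A" "y \<in> A" "x \<noteq> y" for x y
  proof -
    have "y \<ominus> y \<notin> A" using \<open>\<zero> \<notin> A\<close> carr[OF \<open>y \<in> A\<close>] by (simp add: a_minus_def r_neg)
    with at_most_one_missed[OF A \<open>finite A\<close> \<open>y \<in> A\<close> \<open>y \<in> A\<close> \<open>x \<in> A\<close>] \<open>x \<noteq> y\<close>
    show ?thesis by auto
  qed
  have torsion: "x \<oplus> x = \<zero>" if "x \<in> A" for x
  proof -
    obtain y where "y \<in> A" "y \<noteq> x" using \<open>a \<in> A\<close> \<open>A \<noteq> {a}\<close> that by blast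
    with that show ?thesis
      by (intro double_zero_if_sum_diff_mem[OF A, of y])
        (auto intro: carr diff distinct_sum_mem[OF A] dest: no_double)
  qed
  have "additive_subgroup (insert \<zero> A) G"
  proof (rule additive_subgroupI_diff)
    fix x y assume xy: "x \<in> insert \<zero> A" "y \<in> insert \<zero> A"
    then have "x \<in> carrier G" "y \<in> carrier G" "\<ominus> y = y"
      using torsion carr by (auto intro: minus_equality)
    then have "y \<ominus> y = \<zero>" "\<zero> \<ominus> y = y" "x \<ominus> \<zero> = x"
      using r_neg[of y] by (simp_all add: a_minus_def)
    with xy diff[of x y] show "x \<ominus> y \<in> insert \<zero> A"
      by (cases "x = y") auto
  qed (use carr in auto)
  with torsion show ?thesis by auto
qed

text \<open>
  A further element \<open>x\<close> would make \<open>a \<ominus> x\<close> an element of \<open>A\<close>: it is a sum of distinct elements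
  if \<open>\<ominus> x \<in> A\<close>, and otherwise \<open>\<zero>\<close> is the point missed by the translation by \<open>x\<close>, so that \<open>a\<close>
  is not. Hence \<open>x \<oplus> x = \<zero>\<close>, and then \<open>a \<oplus> a\<close> is a sum of two elements of \<open>A\<close> in a second way.
\<close>

lemma subset_zero_plus_minus:
  assumes A: "closed_under_distinct_sums A" and "finite A" and zero: "\<zero> \<in> A"
    and a: "a \<in> A" "a \<oplus> a \<notin> A"
  shows "A \<subseteq> {\<zero>, a, \<ominus> a}"
proof (rule ccontr)
  assume "\<not> A \<subseteq> {\<zero>, a, \<ominus> a}"
  then obtain x where x: "x \<in> A" "x \<noteq> \<zero>" "x \<noteq> a" "x \<noteq> \<ominus> a" by blast
  note carr = distinct_sums_carrier[OF A]
  have ac: "a \<in> carrier G" and xc: "x \<in> carrier G" using carr a x by auto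
  have ax: "a \<oplus> x \<in> A" using distinct_sum_mem[OF A] a x by auto
  have "a \<ominus> x \<in> A"
  proof (cases "\<ominus> x \<in> A")
    case True
    moreover have "\<ominus> x \<noteq> a" using x(4) xc by auto
    ultimately show ?thesis
      using distinct_sum_mem[OF A a(1)] by (simp add: a_minus_def)
  next
    case False
    then have "\<zero> \<ominus> x \<notin> A" using xc by (simp add: a_minus_def)
    moreover have "a \<noteq> \<zero>" using a zero by auto
    ultimately show ?thesis
      using at_most_one_missed[OF A \<open>finite A\<close> x(1) zero a(1)] by blast
  qed
  then have xx: "x \<oplus> x = \<zero>"
    using double_zero_if_sum_diff_mem[OF A ac xc ax] a(2) by simp
  \<comment> \<open>Now \<open>x\<close> has order two, and \<open>x\<close> and \<open>a \<oplus> (a \<oplus> x)\<close> are two elements with sum \<open>a \<oplus> a\<close>;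
    they can only coincide if \<open>a \<oplus> a = \<zero>\<close>.\<close>
  have "a \<oplus> x \<noteq> a" using x(2) ac xc by simp
  then have aax: "a \<oplus> (a \<oplus> x) \<in> A" using distinct_sum_mem[OF A a(1) ax] by simp
  have "x \<oplus> (a \<oplus> (a \<oplus> x)) = (a \<oplus> a) \<oplus> (x \<oplus> x)" using ac xc by (simp add: a_ac)
  also have "\<dots> = a \<oplus> a" using xx ac by simp
  finally have "x = a \<oplus> (a \<oplus> x)"
    using distinct_sum_mem[OF A x(1) aax] a(2) by auto
  then have "(a \<oplus> a) \<oplus> x = x" using ac xc by (simp add: a_assoc)
  then have "a \<oplus> a = \<zero>" using ac xc add.r_cancel_one[of x "a \<oplus> a"] by simp
  with a(2) zero show False by simp
qed

end

theorem proposition1p1: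
  fixes G :: "('g, 'm) ring_scheme" (structure) and A :: "'g set"
  assumes "abelian_group G"
    and "A \<subseteq> carrier G"
    and "finite A"
  shows "phi G A = 1 \<longleftrightarrow>
      (\<exists>H. additive_subgroup H G \<and> A = H)
    \<or> (\<exists>H. additive_subgroup H G \<and> (\<forall>x\<in>H. x \<oplus> x = \<zero>) \<and> H \<noteq> {\<zero>} \<and> A = H - {\<zero>})
    \<or> (\<exists>b\<in>carrier G. A = {b})
    \<or> (\<exists>b\<in>carrier G. A = {b, \<zero>})
    \<or> (\<exists>b\<in>carrier G. A = {b, \<zero>, \<ominus> b})" (is "_ \<longleftrightarrow> ?cases")
proof -
  interpret abelian_group G by fact
  have forward: "?cases" if "A \<noteq> {}" and A: "closed_under_distinct_sums A"
  proof (cases "\<forall>a\<in>A. a \<oplus> a \<in> A")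
    case True
    then have "additive_subgroup A G"
      using assms(2) \<open>A \<noteq> {}\<close> diff_mem_if_double_mem[OF A \<open>finite A\<close>]
      by (intro additive_subgroupI_diff) auto
    then show ?thesis by blast
  next
    case False
    then obtain a where a: "a \<in> A" "a \<oplus> a \<notin> A" by blast
    then have ac: "a \<in> carrier G" using assms(2) by blast
    show ?thesis
    proof (cases "\<zero> \<in> A")
      case True
      with subset_zero_plus_minus[OF A \<open>finite A\<close> True a] a
      have "A = {a, \<zero>} \<or> A = {a, \<zero>, \<ominus> a}" by blast
      with ac show ?thesis by blast
    next
      case False
      show ?thesis
      proof (cases "A = {a}")
        case True
        with ac show ?thesis by blast
      next
        case neq: False
        have "A = insert \<zero> A - {\<zero>}" "insert \<zero> A \<noteq> {\<zero>}" using a False by auto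
        with zero_free_classification[OF A \<open>finite A\<close> False a(1) neq]
        show ?thesis by blast
      qed
    qed
  qed
  have backward: "A \<noteq> {} \<and> closed_under_distinct_sums A" if ?cases
    using that
  proof (elim disjE exE bexE conjE)
    fix H assume "additive_subgroup H G" "A = H"
    then interpret H: additive_subgroup A G by simp
    show ?thesis
      using H.zero_closed H.a_closed assms(2) unfolding closed_under_distinct_sums_def by blast
  next
    fix H assume H: "additive_subgroup H G" "\<forall>x\<in>H. x \<oplus> x = \<zero>" "H \<noteq> {\<zero>}" "A = H - {\<zero>}"
    interpret H: additive_subgroup H G by fact
    \<comment> \<open>In a 2-torsion group every element is its own inverse, so distinct elements do not sum to
      \<open>\<zero>\<close>.\<close>
    have "x = y" if "x \<in> H" "y \<in> H" "x \<oplus> y = \<zero>" for x y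
      using that H(2) minus_equality[of x y] minus_equality[of y y] H.a_subset by auto
    then have "x \<oplus> y \<in> A" if "x \<in> A" "y \<in> A" "x \<noteq> y" for x y
      using that H.a_closed unfolding H(4) by blast
    moreover have "A \<noteq> {}"
      using H(3,4) H.zero_closed by blast
    ultimately show ?thesis
      using assms(2) unfolding closed_under_distinct_sums_def by blast
  qed (use assms(2) in \<open>auto simp: closed_under_distinct_sums_def r_neg l_neg\<close>)
  show ?thesis
    unfolding phi_eq_1_iff[OF assms(2)]
    by (rule iffI, erule conjE, rule forward, assumption+, rule backward)
qed

end
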